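(* Let $A$ be a finite set with at least three elements and let $\eta=\{(a,b)\in A^2\mid a\neq b\}$. Then $\mathrm{PPol}(\eta)=\mathrm{Deg}(A)$.
   Context: $B_n(A)=\mathrm{Sym}(A^n)$, $B(A)=\bigcup_n B_n(A)$. For a relation $R\subseteq A^k$, $\mathrm{PPol}(R)$ is the set of $f\in B_n(A)$ ($n\in\mathbb{N}$) such that for every $k\times n$ array with all columns in $R$, applying $f$ to each row yields an array with all columns in $R$. For $\alpha\in S_n$, $\pi_\alpha(x_1,\dots,x_n)=(x_{\alpha^{-1}(1)},\dots,x_{\alpha^{-1}(n)})$. $\mathrm{Deg}(A)=\{\pi_\alpha\bullet(\beta_1\oplus\dots\oplus\beta_n)\mid n\in\mathbb{N},\alpha\in S_n,\beta_i\in\mathrm{Sym}(A)\}$, where $\beta_1\oplus\dots\oplus\beta_n$ acts coordinatewise by $\beta_i$ on the $i$-th coordinate and $\bullet$ is composition; i.e. $\mathrm{Deg}(A)=\bigcup_n \mathrm{Sym}(A)\,\mathrm{wr}\,S_n$ (the degenerate, or essentially unary, permutations). *)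

theory Defs
  imports
    "HOL-Algebra.Bij"
    "HOL-Library.NList"
    "HOL-Combinatorics.Permutations"
begin

text \<open>
  Elements of \<open>A\<^sup>n\<close> are lists in \<^term>\<open>nlists n A\<close>, with coordinates numbered from \<open>0\<close>.
  Permutations are extensional, i.e. \<^const>\<open>undefined\<close> outside their domain, rather than the
  identity there; otherwise the identities of all the \<open>A\<^sup>n\<close> would be one and the same function.
  For \<open>card A \<ge> 2\<close> a function thus lies in \<open>B\<^sub>n(A)\<close> for at most one \<open>n\<close>
  (see \<open>B_arity_unique\<close>).
\<close>

definition B :: "nat \<Rightarrow> 'a set \<Rightarrow> ('a list \<Rightarrow> 'a list) set" where
  "B n A = Bij (nlists n A)"

text \<open>An array is the list of its rows.\<close>

definition column :: "'a list list \<Rightarrow> nat \<Rightarrow> 'a list" where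
  "column M j = map (\<lambda>r. r ! j) M"

definition preserves :: "nat \<Rightarrow> 'a set \<Rightarrow> nat \<Rightarrow> 'a list set \<Rightarrow> ('a list \<Rightarrow> 'a list) \<Rightarrow> bool" where
  "preserves n A k R f \<longleftrightarrow>
    (\<forall>M \<in> nlists k (nlists n A).
       (\<forall>j<n. column M j \<in> R) \<longrightarrow> (\<forall>j<n. column (map f M) j \<in> R))"

definition PPol :: "'a set \<Rightarrow> nat \<Rightarrow> 'a list set \<Rightarrow> ('a list \<Rightarrow> 'a list) set" where
  "PPol A k R = (\<Union>n. {f \<in> B n A. preserves n A k R f})"

definition wire_perm :: "nat \<Rightarrow> 'a set \<Rightarrow> (nat \<Rightarrow> nat) \<Rightarrow> 'a list \<Rightarrow> 'a list" where
  "wire_perm n A \<alpha> = (\<lambda>x\<in>nlists n A. map (\<lambda>i. x ! (Hilbert_Choice.inv \<alpha> i)) [0..<n])"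

definition coordwise :: "nat \<Rightarrow> 'a set \<Rightarrow> (nat \<Rightarrow> 'a \<Rightarrow> 'a) \<Rightarrow> 'a list \<Rightarrow> 'a list" where
  "coordwise n A \<beta> = (\<lambda>x\<in>nlists n A. map (\<lambda>i. \<beta> i (x ! i)) [0..<n])"

definition Deg :: "'a set \<Rightarrow> ('a list \<Rightarrow> 'a list) set" where
  "Deg A = {compose (nlists n A) (wire_perm n A \<alpha>) (coordwise n A \<beta>) | n \<alpha> \<beta>.
              \<alpha> permutes {..<n} \<and> (\<forall>i<n. \<beta> i \<in> Bij A)}"

definition neq_rel :: "'a set \<Rightarrow> 'a list set" where
  "neq_rel A = {[a, b] | a b. a \<in> A \<and> b \<in> A \<and> a \<noteq> b}"

lemma B_arity_unique:
  assumes "card A \<ge> 2" and "f \<in> B m A" and "f \<in> B n A"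
  shows "m = n"
proof -
  have *: False if f: "f \<in> B m A" "f \<in> B n A" and ne: "m \<noteq> n" and m: "m > 0" for m n
  proof -
    obtain T where "T \<subseteq> A" "card T = 2"
      using assms(1) by (rule obtain_subset_with_card_n)
    moreover from this(2) obtain a b where "T = {a, b}" "a \<noteq> b"
      unfolding card_2_iff by blast
    ultimately have ab: "a \<in> A" "b \<in> A" "a \<noteq> b"
      by simp_all
    let ?x = "replicate m a" and ?y = "replicate m b"
    have in_m: "?x \<in> nlists m A" "?y \<in> nlists m A"
      using ab by (auto intro!: nlistsI)
    have "?x \<notin> nlists n A" "?y \<notin> nlists n A"
      using ne by (auto dest: nlistsE_length)
    then have "f ?x = f ?y"
      using f(2) by (simp add: B_def Bij_def extensional_def)
    moreover have "inj_on f (nlists m A)"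
      using f(1) by (simp add: B_def Bij_def bij_betw_def)
    ultimately have "?x = ?y"
      using in_m by (simp only: inj_on_eq_iff)
    then show False
      using m ab(3) by simp
  qed
  show ?thesis
  proof (rule ccontr)
    assume "m \<noteq> n"
    then show False
      using *[OF assms(2,3)] *[OF assms(3,2)] by (cases "m > 0") simp_all
  qed
qed

end

theory Submission
  imports Defs
begin

text \<open>
  Points at Hamming distance \<open>h\<close> in \<open>A\<^sup>n\<close> have \<open>(q - 1)\<^bsup>n - h\<^esup> (q - 2)\<^bsup>h\<^esup>\<close> common everywhere-different
  points, where \<open>q = card A\<close>. For \<open>q \<ge> 3\<close> this is strictly decreasing in \<open>h\<close>, so a permutation
  preserving \<open>\<noteq>\<close> does not increase the Hamming distance; as \<open>A\<^sup>n\<close> is finite, it is a Hamming isometry.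
  Equality in the triangle inequality means that the two steps change disjoint sets of coordinates,
  so an isometry preserves disjointness of consecutive steps. Hence it maps every line, on which only
  coordinate \<open>i\<close> varies, into a line, and the coordinate \<open>p\<close> varying there is not affected by steps in
  the coordinates other than \<open>i\<close>: coordinate \<open>p\<close> of the image depends on coordinate \<open>i\<close> alone.
\<close>

definition diff_coords :: "nat \<Rightarrow> 'a list \<Rightarrow> 'a list \<Rightarrow> nat set" where
  "diff_coords n x y = {i. i < n \<and> x ! i \<noteq> y ! i}"

definition hamming_dist :: "nat \<Rightarrow> 'a list \<Rightarrow> 'a list \<Rightarrow> nat" where
  "hamming_dist n x y = card (diff_coords n x y)"

lemma in_diff_coords_iff [simp]: "i \<in> diff_coords n x y \<longleftrightarrow> i < n \<and> x ! i \<noteq> y ! i"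
  by (simp add: diff_coords_def)

lemma diff_coords_subset: "diff_coords n x y \<subseteq> {..<n}"
  by auto

lemma finite_diff_coords [simp]: "finite (diff_coords n x y)"
  using diff_coords_subset finite_lessThan by (rule finite_subset)

lemma diff_coords_triangle: "diff_coords n x z \<subseteq> diff_coords n x y \<union> diff_coords n y z"
  by auto

lemma hamming_dist_le: "hamming_dist n x y \<le> n"
  using card_mono[OF finite_lessThan diff_coords_subset] by (simp add: hamming_dist_def)

lemma hamming_dist_eq_full_iff: "hamming_dist n x y = n \<longleftrightarrow> (\<forall>i<n. x ! i \<noteq> y ! i)"
proof -
  have "hamming_dist n x y = n \<longleftrightarrow> diff_coords n x y = {..<n}"
    using card_subset_eq[OF finite_lessThan diff_coords_subset, of n x y]
    unfolding hamming_dist_def by fastforce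
  then show ?thesis
    by (auto simp: set_eq_iff)
qed

lemma hamming_dist_add_iff:
  "hamming_dist n x z = hamming_dist n x y + hamming_dist n y z \<longleftrightarrow>
    diff_coords n x y \<inter> diff_coords n y z = {}" (is "?add \<longleftrightarrow> ?X \<inter> ?Z = {}")
proof
  assume ?add
  moreover have "hamming_dist n x z \<le> card (?X \<union> ?Z)"
    unfolding hamming_dist_def by (intro card_mono diff_coords_triangle) simp
  moreover have "card ?X + card ?Z = card (?X \<union> ?Z) + card (?X \<inter> ?Z)"
    by (intro card_Un_Int) simp_all
  ultimately have "card (?X \<inter> ?Z) = 0"
    by (simp add: hamming_dist_def)
  then show "?X \<inter> ?Z = {}"
    by simp
next
  assume disjoint: "?X \<inter> ?Z = {}"
  then have "diff_coords n x z = ?X \<union> ?Z"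
    by (fastforce simp: diff_coords_def)
  then show ?add
    using disjoint by (simp add: hamming_dist_def card_Un_disjoint)
qed

lemma diff_coords_list_update:
  assumes "i < n" "length x = n" "c \<noteq> e"
  shows "diff_coords n (x[i := c]) (x[i := e]) = {i}"
  using assms by (auto simp: nth_list_update split: if_splits)

lemma finite_nlists:
  assumes "finite A"
  shows "finite (nlists n A)"
  using finite_lists_length_eq[OF assms, of n]
  unfolding nlists_def by (simp only: conj_commute)

lemma map_upt_in_nlists_iff: "map g [0..<n] \<in> nlists n A \<longleftrightarrow> (\<forall>i<n. g i \<in> A)"
  unfolding nlists_def by auto

lemma nlists_eqI_permutes:
  assumes "x \<in> nlists n A" "y \<in> nlists n A" "\<alpha> permutes {..<n}"
    and "\<And>i. i < n \<Longrightarrow> x ! \<alpha> i = y ! \<alpha> i"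
  shows "x = y"
proof (rule nth_equalityI)
  show "length x = length y"
    using assms(1,2) by simp
  fix j assume "j < length x"
  then have "j \<in> \<alpha> ` {..<n}"
    using assms(1) permutes_image[OF assms(3)] by simp
  then show "x ! j = y ! j"
    using assms(4) by auto
qed

lemma preserves_neq_rel_iff:
  assumes "f \<in> nlists n A \<rightarrow> nlists n A"
  shows "preserves n A 2 (neq_rel A) f \<longleftrightarrow>
    (\<forall>x \<in> nlists n A. \<forall>y \<in> nlists n A.
       hamming_dist n x y = n \<longrightarrow> hamming_dist n (f x) (f y) = n)"
proof -
  have ball_pairs: "(\<forall>M \<in> nlists 2 S. P M) \<longleftrightarrow> (\<forall>x \<in> S. \<forall>y \<in> S. P [x, y])"
    for S :: "'b set" and P
    by (auto simp: numeral_2_eq_2 in_nlists_Suc_iff)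
  have columns: "(\<forall>j<n. column [x, y] j \<in> neq_rel A) \<longleftrightarrow> hamming_dist n x y = n"
    if "x \<in> nlists n A" "y \<in> nlists n A" for x y
    using that by (auto simp: column_def neq_rel_def hamming_dist_eq_full_iff nlistsE_nth_in)
  show ?thesis
    unfolding preserves_def ball_pairs using assms by (simp add: columns Pi_def)
qed


subsection \<open>Common everywhere-different points\<close>

lemma in_listset_iff: "xs \<in> listset As \<longleftrightarrow> list_all2 (\<in>) xs As"
  by (induction As arbitrary: xs) (auto simp: set_Cons_def list_all2_Cons2)

lemma card_listset: "card (listset As) = prod_list (map card As)"
proof (induction As)
  case (Cons A As)
  have "listset (A # As) = (\<lambda>(x, xs). x # xs) ` (A \<times> listset As)"
    by (auto simp: set_Cons_def)
  moreover have "inj_on (\<lambda>(x, xs). x # xs) (A \<times> listset As)"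
    by (auto simp: inj_on_def)
  ultimately show ?case
    using Cons.IH by (simp add: card_image card_cartesian_product)
qed simp

definition common_neighbours :: "nat \<Rightarrow> 'a set \<Rightarrow> 'a list \<Rightarrow> 'a list \<Rightarrow> 'a list set" where
  "common_neighbours n A x y =
    {z \<in> nlists n A. hamming_dist n x z = n \<and> hamming_dist n y z = n}"

lemma card_common_neighbours:
  assumes "finite A" "x \<in> nlists n A" "y \<in> nlists n A"
  shows "card (common_neighbours n A x y) =
    (card A - 1) ^ (n - hamming_dist n x y) * (card A - 2) ^ hamming_dist n x y"
proof -
  let ?D = "diff_coords n x y" and ?S = "\<lambda>i. A - {x ! i, y ! i}"
  have "common_neighbours n A x y = listset (map ?S [0..<n])"
    unfolding common_neighbours_def nlists_def subset_eq all_set_conv_all_nth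
    by (fastforce simp: hamming_dist_eq_full_iff in_listset_iff list_all2_conv_all_nth)
  then have "card (common_neighbours n A x y) = (\<Prod>i<n. card (?S i))"
    by (simp add: card_listset comp_def prod.list_conv_set_nth atLeast0LessThan)
  also have "\<dots> = (\<Prod>i<n. if i \<in> ?D then card A - 2 else card A - 1)"
    using assms by (intro prod.cong) (auto simp: card_Diff_subset nlistsE_nth_in)
  also have "\<dots> = (card A - 2) ^ card ({..<n} \<inter> ?D) * (card A - 1) ^ card ({..<n} \<inter> - ?D)"
    by (simp only: prod.If_cases finite_lessThan prod_constant Collect_mem_eq)
  also have "{..<n} \<inter> ?D = ?D"
    using diff_coords_subset by (rule Int_absorb1)
  also have "card ({..<n} \<inter> - ?D) = n - card ?D"
    by (simp add: Diff_eq[symmetric] card_Diff_subset diff_coords_subset)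
  finally show ?thesis
    by (simp add: hamming_dist_def mult.commute)
qed

lemma mixed_power_strict_antimono:
  fixes a b :: "'a :: linordered_semidom"
  assumes "0 < a" "a < b" "h < k" "k \<le> n"
  shows "b ^ (n - k) * a ^ k < b ^ (n - h) * a ^ h"
proof -
  have "n - h = (n - k) + (k - h)" "k = h + (k - h)"
    using assms(3,4) by simp_all
  then have "b ^ (n - h) = b ^ (n - k) * b ^ (k - h)" "a ^ k = a ^ h * a ^ (k - h)"
    by (metis power_add)+
  moreover have "(b ^ (n - k) * a ^ h) * a ^ (k - h) < (b ^ (n - k) * a ^ h) * b ^ (k - h)"
    using assms by (intro mult_strict_left_mono power_strict_mono mult_pos_pos zero_less_power) auto
  ultimately show ?thesis
    by (simp add: mult_ac)
qed

lemma bij_betw_nonincreasing_imp_eq: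
  fixes d :: "'a \<Rightarrow> 'a \<Rightarrow> 'b :: ordered_cancel_comm_monoid_add"
  assumes "finite S" "bij_betw f S S"
    and "\<And>x y. x \<in> S \<Longrightarrow> y \<in> S \<Longrightarrow> d (f x) (f y) \<le> d x y"
    and "x \<in> S" "y \<in> S"
  shows "d (f x) (f y) = d x y"
proof -
  let ?d = "\<lambda>p. d (fst p) (snd p)" and ?f = "map_prod f f"
  have "sum (?d \<circ> ?f) (S \<times> S) = sum ?d (S \<times> S)"
    unfolding comp_def using bij_betw_map_prod[OF assms(2,2)] by (rule sum.reindex_bij_betw)
  then have "(?d \<circ> ?f) (x, y) = ?d (x, y)"
    by (rule sum_mono_inv) (use assms(1,3-5) in auto)
  then show ?thesis
    by simp
qed


subsection \<open>Hamming isometries\<close>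

locale hamming_isometry =
  fixes A :: "'a set" and n :: nat and f :: "'a list \<Rightarrow> 'a list"
  assumes in_Bij: "f \<in> Bij (nlists n A)"
    and hamming_dist_image: "\<And>x y. x \<in> nlists n A \<Longrightarrow> y \<in> nlists n A \<Longrightarrow>
      hamming_dist n (f x) (f y) = hamming_dist n x y"

lemma (in hamming_isometry) preserves_neq_rel: "preserves n A 2 (neq_rel A) f"
  using Bij_imp_funcset[OF in_Bij] by (simp add: preserves_neq_rel_iff hamming_dist_image)

lemma neq_preserving_hamming_dist_le:
  assumes "finite A" "card A \<ge> 3" "f \<in> Bij (nlists n A)" "preserves n A 2 (neq_rel A) f"
    and "x \<in> nlists n A" "y \<in> nlists n A"
  shows "hamming_dist n (f x) (f y) \<le> hamming_dist n x y"
proof (rule ccontr)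
  let ?common = "common_neighbours n A"
  assume "\<not> hamming_dist n (f x) (f y) \<le> hamming_dist n x y"
  then have "hamming_dist n x y < hamming_dist n (f x) (f y)"
    by simp
  moreover have "0 < card A - 2" "card A - 2 < card A - 1"
    using assms(2) by simp_all
  moreover have f: "f \<in> nlists n A \<rightarrow> nlists n A" "inj_on f (nlists n A)"
    using assms(3) by (auto simp: Bij_def bij_betw_def)
  ultimately have "card (?common (f x) (f y)) < card (?common x y)"
    using assms(1,5,6) mixed_power_strict_antimono[OF _ _ _ hamming_dist_le]
    by (simp only: card_common_neighbours funcset_mem)
  moreover have "card (?common x y) \<le> card (?common (f x) (f y))"
  proof (rule card_inj_on_le)
    show "inj_on f (?common x y)"
      using f(2) by (rule inj_on_subset) (auto simp: common_neighbours_def)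
    show "f ` ?common x y \<subseteq> ?common (f x) (f y)"
      using assms(4-6) f(1) by (auto simp: preserves_neq_rel_iff common_neighbours_def)
    show "finite (?common (f x) (f y))"
      using finite_nlists[OF assms(1)] by (simp add: common_neighbours_def)
  qed
  ultimately show False
    by simp
qed

lemma preserves_neq_rel_iff_hamming_isometry:
  assumes "finite A" "card A \<ge> 3" "f \<in> Bij (nlists n A)"
  shows "preserves n A 2 (neq_rel A) f \<longleftrightarrow> hamming_isometry A n f"
proof
  assume preserves: "preserves n A 2 (neq_rel A) f"
  have "bij_betw f (nlists n A) (nlists n A)"
    using assms(3) by (simp add: Bij_def)
  then have "hamming_dist n (f x) (f y) = hamming_dist n x y"
    if "x \<in> nlists n A" "y \<in> nlists n A" for x y
    using that bij_betw_nonincreasing_imp_eq[OF finite_nlists[OF assms(1)]]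
      neq_preserving_hamming_dist_le[OF assms preserves] by blast
  then show "hamming_isometry A n f"
    using assms(3) by unfold_locales
qed (rule hamming_isometry.preserves_neq_rel)

subsection \<open>Degenerate permutations\<close>

lemma eq_compose_wire_perm_coordwise_iff:
  assumes \<alpha>: "\<alpha> permutes {..<n}" and \<beta>: "\<And>i. i < n \<Longrightarrow> \<beta> i \<in> A \<rightarrow> A"
  shows "f = compose (nlists n A) (wire_perm n A \<alpha>) (coordwise n A \<beta>) \<longleftrightarrow>
    f \<in> nlists n A \<rightarrow>\<^sub>E nlists n A \<and> (\<forall>x \<in> nlists n A. \<forall>i<n. f x ! \<alpha> i = \<beta> i (x ! i))"
    (is "f = ?g \<longleftrightarrow> _")
proof -
  have perm_less_iff: "\<alpha> i < n \<longleftrightarrow> i < n" "Hilbert_Choice.inv \<alpha> i < n \<longleftrightarrow> i < n" for i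
    using permutes_in_image[OF \<alpha>, of i] permutes_in_image[OF permutes_inv[OF \<alpha>], of i] by simp_all
  have coordwise_in_nlists: "coordwise n A \<beta> x \<in> nlists n A" if "x \<in> nlists n A" for x
    using that by (simp add: coordwise_def map_upt_in_nlists_iff funcset_mem[OF \<beta>] nlistsE_nth_in)
  then have compose_in_PiE: "?g \<in> nlists n A \<rightarrow>\<^sub>E nlists n A"
    by (auto simp: compose_def wire_perm_def map_upt_in_nlists_iff perm_less_iff nlistsE_nth_in[of _ n])
  have compose_nth: "?g x ! \<alpha> i = \<beta> i (x ! i)" if "x \<in> nlists n A" "i < n" for x i
    using that coordwise_in_nlists[OF that(1)]
    by (simp add: compose_eq wire_perm_def perm_less_iff permutes_inverses[OF \<alpha>])
      (simp add: coordwise_def)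
  have "f = ?g"
    if "f \<in> nlists n A \<rightarrow>\<^sub>E nlists n A" "\<forall>x \<in> nlists n A. \<forall>i<n. f x ! \<alpha> i = \<beta> i (x ! i)"
  proof (rule PiE_ext[OF that(1) compose_in_PiE])
    fix x assume "x \<in> nlists n A"
    then show "f x = ?g x"
      using that compose_in_PiE compose_nth by (intro nlists_eqI_permutes[OF _ _ \<alpha>]) auto
  qed
  then show ?thesis
    using compose_in_PiE compose_nth by blast
qed

locale degenerate_permutation =
  fixes A :: "'a set" and n :: nat and \<alpha> :: "nat \<Rightarrow> nat" and \<beta> :: "nat \<Rightarrow> 'a \<Rightarrow> 'a"
    and f :: "'a list \<Rightarrow> 'a list"
  assumes permutes: "\<alpha> permutes {..<n}"
    and coord_in_Bij: "i < n \<Longrightarrow> \<beta> i \<in> Bij A"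
    and in_PiE: "f \<in> nlists n A \<rightarrow>\<^sub>E nlists n A"
    and image_nth: "\<lbrakk>x \<in> nlists n A; i < n\<rbrakk> \<Longrightarrow> f x ! \<alpha> i = \<beta> i (x ! i)"

lemma in_Deg_iff: "f \<in> Deg A \<longleftrightarrow> (\<exists>n \<alpha> \<beta>. degenerate_permutation A n \<alpha> \<beta> f)"
  unfolding Deg_def mem_Collect_eq
proof (intro ex_cong1)
  fix n \<alpha> \<beta>
  show "(f = compose (nlists n A) (wire_perm n A \<alpha>) (coordwise n A \<beta>) \<and>
      \<alpha> permutes {..<n} \<and> (\<forall>i<n. \<beta> i \<in> Bij A)) \<longleftrightarrow> degenerate_permutation A n \<alpha> \<beta> f"
  proof (cases "\<alpha> permutes {..<n} \<and> (\<forall>i<n. \<beta> i \<in> Bij A)")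
    case True
    then show ?thesis
      using eq_compose_wire_perm_coordwise_iff[of \<alpha> n \<beta> A f]
      by (simp add: degenerate_permutation_def Bij_imp_funcset Ball_def)
  qed (auto simp: degenerate_permutation_def)
qed

context degenerate_permutation
begin

lemma coord_eq_iff:
  assumes "x \<in> nlists n A" "y \<in> nlists n A" "i < n"
  shows "\<beta> i (x ! i) = \<beta> i (y ! i) \<longleftrightarrow> x ! i = y ! i"
  using coord_in_Bij[OF assms(3)] assms
  by (auto simp: Bij_def bij_betw_def inj_on_eq_iff nlistsE_nth_in)

lemma in_image: "y \<in> f ` nlists n A" if y: "y \<in> nlists n A"
proof -
  have y_nth: "y ! \<alpha> i \<in> \<beta> i ` A" if "i < n" for i
    using coord_in_Bij[OF that] y permutes_in_image[OF permutes, of i] that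
    by (auto simp: Bij_def bij_betw_def nlistsE_nth_in)
  define x where "x = map (\<lambda>i. inv_into A (\<beta> i) (y ! \<alpha> i)) [0..<n]"
  have x: "x \<in> nlists n A"
    using y_nth by (simp add: x_def map_upt_in_nlists_iff inv_into_into)
  have "f x ! \<alpha> i = y ! \<alpha> i" if "i < n" for i
    using image_nth[OF x that] y_nth[OF that] that by (simp add: x_def f_inv_into_f)
  then have "f x = y"
    using in_PiE x y by (intro nlists_eqI_permutes[OF _ _ permutes]) auto
  then show ?thesis
    using x by blast
qed

lemma in_Bij: "f \<in> Bij (nlists n A)"
proof -
  have "inj_on f (nlists n A)"
  proof (rule inj_onI)
    fix x y assume xy: "x \<in> nlists n A" "y \<in> nlists n A" "f x = f y"
    then have "x ! i = y ! i" if "i < n" for i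
      using image_nth[OF _ that] coord_eq_iff[OF _ _ that] by metis
    then show "x = y"
      using xy by (intro nlists_eqI_permutes[OF _ _ permutes_id]) simp_all
  qed
  then show ?thesis
    using in_PiE in_image by (auto simp: Bij_def bij_betw_def PiE_def)
qed

lemma diff_coords_image:
  assumes "x \<in> nlists n A" "y \<in> nlists n A"
  shows "diff_coords n (f x) (f y) = \<alpha> ` diff_coords n x y"
proof -
  have "diff_coords n (f x) (f y) = {j \<in> \<alpha> ` {..<n}. f x ! j \<noteq> f y ! j}"
    by (auto simp: permutes_image[OF permutes])
  also have "\<dots> = \<alpha> ` diff_coords n x y"
    using assms by (auto simp: image_nth coord_eq_iff)
  finally show ?thesis .
qed

sublocale hamming_isometry A n f
  using in_Bij
  by unfold_locales
    (simp_all add: hamming_dist_def diff_coords_image card_image permutes_inj_on[OF permutes])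

end


subsection \<open>Hamming isometries are degenerate\<close>

context hamming_isometry
begin

abbreviation D :: "'a list \<Rightarrow> 'a list \<Rightarrow> nat set" where
  "D \<equiv> diff_coords n"

lemma image_in_nlists: "x \<in> nlists n A \<Longrightarrow> f x \<in> nlists n A"
  using Bij_imp_funcset[OF in_Bij] by auto

lemma diff_coords_image_disjoint_iff:
  assumes "x \<in> nlists n A" "y \<in> nlists n A" "z \<in> nlists n A"
  shows "D (f x) (f y) \<inter> D (f y) (f z) = {} \<longleftrightarrow> D x y \<inter> D y z = {}"
  using assms by (simp add: hamming_dist_add_iff[symmetric] hamming_dist_image)

context
  fixes a b
  assumes distinct_elements: "a \<in> A" "b \<in> A" "a \<noteq> b"
begin

lemma line_image:
  assumes x: "x \<in> nlists n A" and "i < n"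
  obtains p where "\<And>c e. \<lbrakk>c \<in> A; e \<in> A; c \<noteq> e\<rbrakk> \<Longrightarrow> D (f (x[i := c])) (f (x[i := e])) = {p}"
proof -
  let ?L = "\<lambda>c. x[i := c]"
  have diff_coords_line: "D (?L c) (?L e) = {i}" if "c \<noteq> e" for c e
    using that x \<open>i < n\<close> by (simp add: diff_coords_list_update)
  have image_singleton: "\<exists>q. D (f (?L c)) (f (?L e)) = {q}" if "c \<in> A" "e \<in> A" "c \<noteq> e" for c e
    using hamming_dist_image[of "?L c" "?L e"] that x
    by (simp add: hamming_dist_def diff_coords_line card_1_singleton_iff)
  obtain p where p: "D (f (?L a)) (f (?L b)) = {p}"
    using image_singleton distinct_elements by blast
  have image_through_a: "D (f (?L c)) (f (?L a)) = {p}" if "c \<in> A" "c \<noteq> a" for c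
  proof -
    have "D (f (?L c)) (f (?L a)) \<inter> {p} \<noteq> {}"
      using diff_coords_image_disjoint_iff[of "?L c" "?L a" "?L b"] that distinct_elements x
      by (simp add: diff_coords_line p)
    then show ?thesis
      using image_singleton that distinct_elements(1) by fastforce
  qed
  show ?thesis
  proof
    fix c e assume ce: "c \<in> A" "e \<in> A" "c \<noteq> e"
    have "D (f (?L c)) (f (?L e)) \<subseteq> D (f (?L c)) (f (?L a)) \<union> D (f (?L e)) (f (?L a))"
      by auto
    also have "\<dots> \<subseteq> {p}"
      using image_through_a ce by (cases "c = a"; cases "e = a") auto
    finally show "D (f (?L c)) (f (?L e)) = {p}"
      using image_singleton ce by blast
  qed
qed

text \<open>
  The step to \<open>y[i := x ! i]\<close> from another point of the line and the step on to \<open>x\<close> change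
  disjoint sets of coordinates, and the image of the former already changes coordinate \<open>p\<close>.
\<close>

lemma image_nth_eq_line_image:
  assumes x: "x \<in> nlists n A" and y: "y \<in> nlists n A" and "i < n"
    and line: "\<And>c e. \<lbrakk>c \<in> A; e \<in> A; c \<noteq> e\<rbrakk> \<Longrightarrow> D (f (y[i := c])) (f (y[i := e])) = {p}"
  shows "f x ! p = f (y[i := x ! i]) ! p"
proof -
  let ?L = "\<lambda>c. y[i := c]"
  have x_nth: "x ! i \<in> A"
    using x \<open>i < n\<close> by (rule nlistsE_nth_in)
  obtain e where e: "e \<in> A" "e \<noteq> x ! i"
    using distinct_elements by metis
  have "D (?L e) (?L (x ! i)) \<inter> D (?L (x ! i)) x = {}"
    using e(2) y \<open>i < n\<close> by (simp add: diff_coords_list_update)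
  then have "D (f (?L e)) (f (?L (x ! i))) \<inter> D (f (?L (x ! i))) (f x) = {}"
    using diff_coords_image_disjoint_iff x y e(1) x_nth by simp
  then have "p \<notin> D (f (?L (x ! i))) (f x)"
    using line[OF e(1) x_nth e(2)] by simp
  moreover have "p < n"
    using line[OF e(1) x_nth e(2)] by (metis in_diff_coords_iff singletonI)
  ultimately show ?thesis
    by simp
qed

lemma image_coord_factors:
  assumes "i < n"
  obtains p \<beta> where "p < n" "\<beta> \<in> Bij A" "\<And>x. x \<in> nlists n A \<Longrightarrow> f x ! p = \<beta> (x ! i)"
proof -
  let ?L = "\<lambda>c. (replicate n a)[i := c]"
  have base: "replicate n a \<in> nlists n A"
    using distinct_elements(1) by blast
  obtain p where line: "\<And>c e. \<lbrakk>c \<in> A; e \<in> A; c \<noteq> e\<rbrakk> \<Longrightarrow> D (f (?L c)) (f (?L e)) = {p}"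
    using line_image[OF base \<open>i < n\<close>] by blast
  then have "p < n"
    using distinct_elements by (metis in_diff_coords_iff singletonI)
  define \<beta> where "\<beta> = (\<lambda>c\<in>A. f (?L c) ! p)"
  have image_nth: "f x ! p = \<beta> (x ! i)" if "x \<in> nlists n A" for x
    using image_nth_eq_line_image[OF that base \<open>i < n\<close> line] that \<open>i < n\<close>
    by (simp add: \<beta>_def nlistsE_nth_in)
  have "inj_on \<beta> A"
    using line by (fastforce simp: inj_on_def \<beta>_def)
  moreover have "\<beta> ` A \<subseteq> A"
    using \<open>p < n\<close> base image_in_nlists by (auto simp: \<beta>_def intro!: nlistsE_nth_in)
  moreover have "A \<subseteq> \<beta> ` A"
  proof
    fix c assume "c \<in> A"
    then have "replicate n c \<in> f ` nlists n A"
      using in_Bij by (auto simp: Bij_def bij_betw_def)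
    then obtain x where x: "x \<in> nlists n A" "f x = replicate n c"
      by force
    then have "c = \<beta> (x ! i)"
      using image_nth[OF x(1)] \<open>p < n\<close> by simp
    then show "c \<in> \<beta> ` A"
      using nlistsE_nth_in[OF x(1) \<open>i < n\<close>] by blast
  qed
  ultimately have "\<beta> \<in> Bij A"
    by (auto simp: Bij_def bij_betw_def \<beta>_def)
  then show ?thesis
    using that \<open>p < n\<close> image_nth by blast
qed

lemma ex_degenerate_permutation: "\<exists>\<alpha> \<beta>. degenerate_permutation A n \<alpha> \<beta> f"
proof -
  have "\<forall>i<n. \<exists>p \<beta>. p < n \<and> \<beta> \<in> Bij A \<and> (\<forall>x \<in> nlists n A. f x ! p = \<beta> (x ! i))"
    using image_coord_factors by metis
  then obtain \<sigma> \<beta> where \<sigma>: "\<And>i. i < n \<Longrightarrow> \<sigma> i < n" and \<beta>: "\<And>i. i < n \<Longrightarrow> \<beta> i \<in> Bij A"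
    and f_nth: "\<And>x i. \<lbrakk>x \<in> nlists n A; i < n\<rbrakk> \<Longrightarrow> f x ! \<sigma> i = \<beta> i (x ! i)"
    by metis
  have "inj_on \<sigma> {..<n}"
  proof (rule inj_onI, rule ccontr)
    fix i k assume ik: "i \<in> {..<n}" "k \<in> {..<n}" "\<sigma> i = \<sigma> k" "i \<noteq> k"
    let ?x = "replicate n a" and ?y = "(replicate n a)[i := b]"
    have "?x \<in> nlists n A" "?y \<in> nlists n A"
      using distinct_elements by blast+
    then have "\<beta> i a = \<beta> i b"
      using f_nth[of ?x i] f_nth[of ?y i] f_nth[of ?x k] f_nth[of ?y k] ik by simp
    then show False
      using \<beta>[of i] ik(1) distinct_elements by (auto simp: Bij_def bij_betw_def inj_on_eq_iff)
  qed
  then have "bij_betw \<sigma> {..<n} {..<n}"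
    using \<sigma> endo_inj_surj[of "{..<n}" \<sigma>] by (simp add: bij_betw_def image_subset_iff)
  define \<alpha> where "\<alpha> i = (if i < n then \<sigma> i else i)" for i
  have "bij_betw \<alpha> {..<n} {..<n}"
    using \<open>bij_betw \<sigma> {..<n} {..<n}\<close> by (subst bij_betw_cong[of _ _ \<sigma>]) (simp_all add: \<alpha>_def)
  then have "\<alpha> permutes {..<n}"
    by (rule bij_imp_permutes) (simp add: \<alpha>_def)
  moreover have "f \<in> nlists n A \<rightarrow>\<^sub>E nlists n A"
    using Bij_imp_funcset[OF in_Bij] Bij_imp_extensional[OF in_Bij] by (simp add: PiE_def)
  ultimately have "degenerate_permutation A n \<alpha> \<beta> f"
    using \<beta> by unfold_locales (simp_all add: \<alpha>_def f_nth)
  then show ?thesis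
    by blast
qed

end

end

theorem Deg_eq_hamming_isometries:
  assumes "a \<in> A" "b \<in> A" "a \<noteq> b"
  shows "Deg A = {f. \<exists>n. hamming_isometry A n f}"
proof (intro Set.set_eqI iffI)
  fix f assume "f \<in> Deg A"
  then obtain n \<alpha> \<beta> where "degenerate_permutation A n \<alpha> \<beta> f"
    unfolding in_Deg_iff by auto
  then interpret degenerate_permutation A n \<alpha> \<beta> f .
  show "f \<in> {f. \<exists>n. hamming_isometry A n f}"
    using hamming_isometry_axioms by auto
next
  fix f assume "f \<in> {f. \<exists>n. hamming_isometry A n f}"
  then obtain n where "hamming_isometry A n f"
    by auto
  then show "f \<in> Deg A"
    unfolding in_Deg_iff using hamming_isometry.ex_degenerate_permutation[OF _ assms] by metis
qed

theorem theorem7: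
  fixes A :: "'a set"
  assumes "finite A" and "card A \<ge> 3"
  shows "PPol A 2 (neq_rel A) = Deg A"
proof -
  have "PPol A 2 (neq_rel A) = {f. \<exists>n. hamming_isometry A n f}"
    using preserves_neq_rel_iff_hamming_isometry[OF assms] hamming_isometry.in_Bij
    unfolding PPol_def B_def by blast
  also obtain a b where "a \<in> A" "b \<in> A" "a \<noteq> b"
    using assms card_le_Suc0_iff_eq[OF assms(1)] by auto
  then have "{f. \<exists>n. hamming_isometry A n f} = Deg A"
    by (rule Deg_eq_hamming_isometries[symmetric])
  finally show ?thesis .
qed

end
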